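(* Let $n\ge 1$. Each of the sets $A_n$, $R_n$ and $S_n$, listed in Reflected Gray Code order $\prec$, is a $3$-adjacent Gray code: any two consecutive sequences in the list differ in at most $3$ positions, and the positions in which they differ form a set of consecutive integers.
   Context: All sequences are finite sequences of non-negative integers. For a sequence $s_1s_2\ldots s_k$ define the statistics $\mathrm{asc}(s_1\ldots s_k)=\#\{i: 1\le i<k,\ s_i<s_{i+1}\}$, $\max(s_1\ldots s_k)=\max\{s_1,\ldots,s_k\}$, and $\mathrm{lv}(s_1\ldots s_k)=s_k$. For a statistic $\mathrm{st}$, a sequence $s_1s_2\ldots s_n$ is an $\mathrm{st}$-restricted growth sequence if $s_1=0$ and $0\le s_{k+1}\le \mathrm{st}(s_1\ldots s_k)+1$ for all $1\le k<n$. $A_n$ (ascent sequences), $R_n$ (restricted growth functions) and $S_n$ (staircase words) are the sets of length-$n$ $\mathrm{st}$-restricted growth sequences for $\mathrm{st}=\mathrm{asc}$, $\max$, $\mathrm{lv}$ respectively. Reflected Gray Code order on length-$n$ sequences: $s\prec t$ if, with $k$ the leftmost position where $s$ and $t$ differ, either $\sum_{i=1}^{k-1}s_i$ is even and $s_k<t_k$, or $\sum_{i=1}^{k-1}s_i$ is odd and $s_k>t_k$. A list of sequences is a $d$-Gray code if the Hamming distance between any two consecutive sequences is at most $d$; it is a $d$-adjacent Gray code if moreover the positions where consecutive sequences differ are adjacent (consecutive). *)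

theory Defs
  imports Main
begin

text \<open>Sequences are lists of natural numbers. Positions are counted from 0, as usual for lists,
  so the entry \<open>s\<^sub>i\<close> of the source is \<open>s ! (i - 1)\<close> here.\<close>

definition asc :: "nat list \<Rightarrow> nat" where
  "asc s = card {i. Suc i < length s \<and> s ! i < s ! Suc i}"

definition max_entry :: "nat list \<Rightarrow> nat" where
  "max_entry s = Max (set s)"

definition lv :: "nat list \<Rightarrow> nat" where
  "lv s = last s"

text \<open>The statistic is only ever applied to the nonempty prefixes \<open>take k s\<close>, \<open>1 \<le> k\<close>, so the
  unspecified values of \<open>Max {}\<close> and \<open>last []\<close> play no role. For the empty sequence there is no
  first entry; it is excluded.\<close>

definition restricted_growth :: "(nat list \<Rightarrow> nat) \<Rightarrow> nat list \<Rightarrow> bool" where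
  "restricted_growth st s \<longleftrightarrow>
     s \<noteq> [] \<and> s ! 0 = 0 \<and> (\<forall>k. 1 \<le> k \<and> k < length s \<longrightarrow> s ! k \<le> st (take k s) + 1)"

definition restricted_growth_seqs :: "(nat list \<Rightarrow> nat) \<Rightarrow> nat \<Rightarrow> nat list set" where
  "restricted_growth_seqs st n = {s. length s = n \<and> restricted_growth st s}"

definition ascent_seqs :: "nat \<Rightarrow> nat list set" where
  "ascent_seqs n = restricted_growth_seqs asc n"

definition restricted_growth_funs :: "nat \<Rightarrow> nat list set" where
  "restricted_growth_funs n = restricted_growth_seqs max_entry n"

definition staircase_words :: "nat \<Rightarrow> nat list set" where
  "staircase_words n = restricted_growth_seqs lv n"

definition rgc_less :: "nat list \<Rightarrow> nat list \<Rightarrow> bool" (infix "\<prec>" 50) where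
  "s \<prec> t \<longleftrightarrow> length s = length t \<and>
     (\<exists>k < length s. take k s = take k t \<and>
        (even (sum_list (take k s)) \<and> s ! k < t ! k \<or>
         odd (sum_list (take k s)) \<and> s ! k > t ! k))"

text \<open>\<open>L\<close> is the set \<open>X\<close> listed in Reflected Gray Code order. As the order is irreflexive,
  every element of \<open>X\<close> occurs exactly once in \<open>L\<close>.\<close>

definition rgc_listing :: "nat list set \<Rightarrow> nat list list \<Rightarrow> bool" where
  "rgc_listing X L \<longleftrightarrow> set L = X \<and> sorted_wrt (\<prec>) L"

text \<open>Used for sequences of equal length only.\<close>

definition diff_positions :: "nat list \<Rightarrow> nat list \<Rightarrow> nat set" where
  "diff_positions s t = {i. i < length s \<and> s ! i \<noteq> t ! i}"

definition hamming_dist :: "nat list \<Rightarrow> nat list \<Rightarrow> nat" where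
  "hamming_dist s t = card (diff_positions s t)"

definition gray_code :: "nat \<Rightarrow> nat list list \<Rightarrow> bool" where
  "gray_code d L \<longleftrightarrow> (\<forall>i. Suc i < length L \<longrightarrow> hamming_dist (L ! i) (L ! Suc i) \<le> d)"

definition adjacent_gray_code :: "nat \<Rightarrow> nat list list \<Rightarrow> bool" where
  "adjacent_gray_code d L \<longleftrightarrow> gray_code d L \<and>
     (\<forall>i. Suc i < length L \<longrightarrow> (\<exists>a b. diff_positions (L ! i) (L ! Suc i) = {a..b}))"

end

theory Submission
  imports Defs
begin

text \<open>Let \<open>s \<prec> t\<close> be consecutive, with first difference at \<open>k\<close>. Admissible values of an entry form an
  interval, so \<open>s\<^sub>k\<close> and \<open>t\<^sub>k\<close> differ by one; every prefix extends by zeros, so \<open>s\<close> is the greatest and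
  \<open>t\<close> the least sequence with its prefix of length \<open>k + 1\<close>. Hence each later entry is greedy: either
  zero or the maximum \<open>st + 1\<close>, depending on the parity of the preceding sum. The two prefixes have
  opposite parities, so both tails start in the same mode. An entry zero keeps the parity and thus
  forces zeros from there on; an odd maximal entry also leads to zeros. Since
  \<open>st (q \<cdot> (st q + 1)) = st q + 1\<close> for the three statistics, an even maximal entry is followed by its
  (odd) successor, so that all entries after position \<open>k + 2\<close> vanish.\<close>

section \<open>Listings of finite strictly ordered sets\<close>

text \<open>Each head is the least element of the common set, so the two lists agree head by
  head.\<close>

lemma sorted_wrt_set_unique:
  assumes "transp R" "irreflp R" "sorted_wrt R L" "sorted_wrt R L'" "set L = set L'"
  shows "L = L'"
  using assms(3-5)
proof (induction L arbitrary: L')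
  case Nil
  then show ?case by simp
next
  case (Cons x xs)
  have asym: "\<not> (R a b \<and> R b a)" for a b
    using assms(1,2) by (meson irreflpD transpD)
  obtain y ys where L': "L' = y # ys"
    using Cons.prems(3) by (cases L') auto
  have "x = y"
  proof (rule ccontr)
    assume "x \<noteq> y"
    then have "x \<in> set ys" "y \<in> set xs"
      using Cons.prems(3) unfolding L' by auto
    then show False
      using Cons.prems(1,2) asym unfolding L' by auto
  qed
  moreover have "x \<notin> set xs" "y \<notin> set ys"
    using Cons.prems(1,2) assms(2) unfolding L' by (auto dest: irreflpD)
  ultimately have "set xs = set ys"
    using Cons.prems(3) unfolding L' by auto
  then show ?case
    using Cons.IH[of ys] Cons.prems \<open>x = y\<close> L' by simp
qed

lemma finite_sorted_wrt_exists:
  assumes "transp R" "finite X" "totalp_on X R"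
  shows "\<exists>L. set L = X \<and> sorted_wrt R L"
  using assms(2,3)
proof (induction X rule: finite_induct)
  case empty
  then show ?case by simp
next
  case (insert x X)
  then obtain L where L: "set L = X" "sorted_wrt R L"
    by (auto simp: totalp_on_def)
  \<comment> \<open>Totality puts every element of \<open>X\<close> on one side of \<open>x\<close>;
    transitivity then orders the two sides against each other.\<close>
  let ?L = "filter (\<lambda>y. R y x) L @ x # filter (R x) L"
  have "set ?L = insert x X"
    using L(1) insert.hyps insert.prems by (auto simp: totalp_on_def)
  moreover have "sorted_wrt R ?L"
    using L(2) assms(1) by (auto simp: sorted_wrt_append sorted_wrt_filter dest: transpD)
  ultimately show ?case by blast
qed

lemma sorted_wrt_no_between:
  assumes "transp R" "irreflp R" "sorted_wrt R L" "Suc i < length L" "u \<in> set L"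
  shows "\<not> (R (L ! i) u \<and> R u (L ! Suc i))"
proof
  assume R: "R (L ! i) u \<and> R u (L ! Suc i)"
  obtain m where m: "m < length L" "u = L ! m"
    using assms(5) by (auto simp: in_set_conv_nth)
  have asym: "\<not> (R a b \<and> R b a)" "\<not> R a a" for a b
    using assms(1,2) by (meson irreflpD transpD)+
  consider "m < i" | "m = i" | "m = Suc i" | "Suc i < m" by linarith
  then show False
    using R m assms(3,4) asym by cases (auto simp: sorted_wrt_iff_nth_less)
qed

section \<open>Reflected Gray Code order\<close>

lemma rgc_lessI:
  assumes "length s = length t" "k < length s" "take k s = take k t"
    and "if even (sum_list (take k s)) then s ! k < t ! k else t ! k < s ! k"
  shows "s \<prec> t"
  using assms unfolding rgc_less_def by (auto split: if_splits)

lemma rgc_lessE: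
  assumes "s \<prec> t"
  obtains k where "length s = length t" "k < length s" "take k s = take k t"
    "if even (sum_list (take k s)) then s ! k < t ! k else t ! k < s ! k"
  using assms unfolding rgc_less_def by auto

lemma take_eq_le:
  assumes "take k s = take k t" "j \<le> k"
  shows "take j s = take j t"
  by (metis assms min.absorb1 take_take)

lemma nth_eq_of_take_eq:
  assumes "take k s = take k t" "j < k"
  shows "s ! j = t ! j"
  by (metis assms nth_take)

lemma irreflp_rgc_less: "irreflp (\<prec>)"
  by (auto simp: irreflp_def rgc_less_def)

lemma transp_rgc_less: "transp (\<prec>)"
proof (rule transpI)
  fix s t u assume "s \<prec> t" "t \<prec> u"
  obtain k where k: "length s = length t" "k < length s" "take k s = take k t"
    "if even (sum_list (take k s)) then s ! k < t ! k else t ! k < s ! k"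
    using \<open>s \<prec> t\<close> by (rule rgc_lessE)
  obtain l where l: "length t = length u" "l < length t" "take l t = take l u"
    "if even (sum_list (take l t)) then t ! l < u ! l else u ! l < t ! l"
    using \<open>t \<prec> u\<close> by (rule rgc_lessE)
  \<comment> \<open>The smaller of the two positions decides: all three prefixes agree up to it, so
    one parity governs every comparison there.\<close>
  consider "k < l" | "k = l" | "l < k" by linarith
  then show "s \<prec> u"
  proof cases
    case 1
    have "take k t = take k u" "t ! k = u ! k"
      using take_eq_le[OF l(3)] nth_eq_of_take_eq[OF l(3)] 1 by auto
    then show ?thesis using k l by (intro rgc_lessI[of _ _ k]) auto
  next
    case 2
    then show ?thesis using k l by (intro rgc_lessI[of _ _ k]) (auto split: if_splits)
  next
    case 3
    have "take l s = take l t" "s ! l = t ! l"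
      using take_eq_le[OF k(3)] nth_eq_of_take_eq[OF k(3)] 3 by auto
    then show ?thesis using k l by (intro rgc_lessI[of _ _ l]) auto
  qed
qed

lemma rgc_less_total:
  assumes "length s = length t" "s \<noteq> t"
  shows "s \<prec> t \<or> t \<prec> s"
proof -
  obtain i where i: "i < length s" "s ! i \<noteq> t ! i"
    using assms nth_equalityI by blast
  define k where "k = (LEAST i. i < length s \<and> s ! i \<noteq> t ! i)"
  have k: "k < length s" "s ! k \<noteq> t ! k"
    using LeastI[of "\<lambda>i. i < length s \<and> s ! i \<noteq> t ! i" i] i unfolding k_def by auto
  have "s ! j = t ! j" if "j < k" for j
    using not_less_Least[of j "\<lambda>i. i < length s \<and> s ! i \<noteq> t ! i"] that k(1) unfolding k_def by auto
  then have "take k s = take k t"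
    using assms(1) by (intro nth_equalityI) auto
  then show ?thesis
    using k assms(1) rgc_lessI[of s t k] rgc_lessI[of t s k]
    by (cases "even (sum_list (take k s))") (simp_all, linarith+)
qed

section \<open>Restricted growth sequences\<close>

lemma restricted_growth_snoc:
  assumes "q \<noteq> []"
  shows "restricted_growth st (q @ [x]) \<longleftrightarrow> restricted_growth st q \<and> x \<le> st q + 1"
proof
  assume A: "restricted_growth st (q @ [x])"
  have "q ! k \<le> st (take k q) + 1" if "1 \<le> k" "k < length q" for k
    using A that unfolding restricted_growth_def
    by (auto simp: nth_append dest!: spec[of _ k])
  moreover have "x \<le> st q + 1"
    using A assms unfolding restricted_growth_def
    by (auto simp: nth_append Suc_le_eq dest!: spec[of _ "length q"])
  ultimately show "restricted_growth st q \<and> x \<le> st q + 1"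
    using A assms by (auto simp: restricted_growth_def nth_append)
next
  assume A: "restricted_growth st q \<and> x \<le> st q + 1"
  then show "restricted_growth st (q @ [x])"
    using assms unfolding restricted_growth_def
    by (auto simp: nth_append less_Suc_eq)
qed

lemma restricted_growth_take:
  assumes "restricted_growth st s" "1 \<le> j"
  shows "restricted_growth st (take j s)"
  using assms unfolding restricted_growth_def by (auto simp: min_def)

lemma restricted_growth_append_zeros:
  assumes "restricted_growth st q"
  shows "restricted_growth st (q @ replicate m 0)"
proof (induction m)
  case 0
  then show ?case using assms by simp
next
  case (Suc m)
  have "q @ replicate m 0 \<noteq> []"
    using assms by (auto simp: restricted_growth_def)
  then have "restricted_growth st ((q @ replicate m 0) @ [0])"
    using Suc restricted_growth_snoc by blast
  then show ?case
    by (simp add: replicate_append_same)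
qed

lemma finite_restricted_growth_seqs: "finite (restricted_growth_seqs st n)"
proof (induction n)
  case 0
  then show ?case by (auto simp: restricted_growth_seqs_def restricted_growth_def)
next
  case (Suc n)
  \<comment> \<open>No sequence has length 0, because \<open>restricted_growth\<close> excludes the
    empty list; \<open>[0]\<close> is therefore added by hand.\<close>
  have "restricted_growth_seqs st (Suc n) \<subseteq>
      insert [0] (\<Union>q \<in> restricted_growth_seqs st n. (\<lambda>x. q @ [x]) ` {..st q + 1})"
  proof
    fix s assume s: "s \<in> restricted_growth_seqs st (Suc n)"
    then obtain q x where qx: "s = q @ [x]"
      by (cases s rule: rev_cases) (auto simp: restricted_growth_seqs_def)
    show "s \<in> insert [0] (\<Union>q \<in> restricted_growth_seqs st n. (\<lambda>x. q @ [x]) ` {..st q + 1})"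
    proof (cases "q = []")
      case True
      then show ?thesis
        using s qx by (auto simp: restricted_growth_seqs_def restricted_growth_def)
    next
      case False
      then show ?thesis
        using s qx restricted_growth_snoc[of q st x] by (auto simp: restricted_growth_seqs_def)
    qed
  qed
  then show ?case
    by (rule finite_subset) (use Suc in auto)
qed

text \<open>Supplies the competitors \<open>u\<close> that would lie strictly between two
  neighbours. Zeros complete any admissible prefix, so only the entry at \<open>j\<close> has to be
  checked.\<close>

lemma restricted_growth_seqs_change_entry:
  assumes s: "s \<in> restricted_growth_seqs st n"
    and j: "1 \<le> j" "j < n" and v: "v \<le> st (take j s) + 1"
  obtains u where "u \<in> restricted_growth_seqs st n" "take j u = take j s" "u ! j = v"
proof
  let ?u = "(take j s @ [v]) @ replicate (n - Suc j) 0"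
  have len: "length s = n" and rg: "restricted_growth st s"
    using s by (auto simp: restricted_growth_seqs_def)
  have "restricted_growth st (take j s @ [v])"
    using restricted_growth_take[OF rg j(1)] v j len by (subst restricted_growth_snoc) auto
  then have "restricted_growth st ?u"
    by (rule restricted_growth_append_zeros)
  then show "?u \<in> restricted_growth_seqs st n"
    using len j by (simp add: restricted_growth_seqs_def)
  show "take j ?u = take j s" "?u ! j = v"
    using len j by (auto simp: nth_append)
qed

lemma restricted_growth_seqs_listing_unique:
  "\<exists>!L. rgc_listing (restricted_growth_seqs st n) L"
proof -
  have "totalp_on (restricted_growth_seqs st n) (\<prec>)"
    using rgc_less_total by (auto simp: totalp_on_def restricted_growth_seqs_def)
  then show ?thesis
    using finite_sorted_wrt_exists[OF transp_rgc_less finite_restricted_growth_seqs]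
      sorted_wrt_set_unique[OF transp_rgc_less irreflp_rgc_less]
    unfolding rgc_listing_def by metis
qed

section \<open>Greedy tails\<close>

text \<open>Beyond position \<open>k\<close>, the greatest sequence with a given prefix is greedy with \<open>e = True\<close>,
  the least one with \<open>e = False\<close>.\<close>

definition greedy_after :: "(nat list \<Rightarrow> nat) \<Rightarrow> bool \<Rightarrow> nat \<Rightarrow> nat list \<Rightarrow> bool" where
  "greedy_after st e k s \<longleftrightarrow> (\<forall>j. k < j \<and> j < length s \<longrightarrow>
     s ! j = (if even (sum_list (take j s)) = e then st (take j s) + 1 else 0))"

lemma greedy_after_mono: "greedy_after st e k s \<Longrightarrow> k \<le> l \<Longrightarrow> greedy_after st e l s"
  by (auto simp: greedy_after_def)

text \<open>The wrong parity forces the entry 0, which leaves the sum and hence the parity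
  unchanged, so the situation persists to the end.\<close>

lemma greedy_after_zeros:
  assumes g: "greedy_after st e k s" and par: "even (sum_list (take (Suc k) s)) \<noteq> e"
    and j: "k < j" "j < length s"
  shows "s ! j = 0"
proof -
  have "Suc k \<le> j" using j by simp
  then have "j < length s \<longrightarrow> even (sum_list (take j s)) \<noteq> e"
  proof (induction j rule: dec_induct)
    case base
    then show ?case using par by simp
  next
    case (step i)
    then show ?case
      using g unfolding greedy_after_def
      by (auto simp: take_Suc_conv_app_nth dest!: spec[of _ i])
  qed
  then show ?thesis
    using g j unfolding greedy_after_def by auto
qed

text \<open>After a maximal entry \<open>m\<close> the next upper bound is \<open>m + 1\<close>, of
  the opposite parity. Restricting to admissible \<open>q\<close> matters for \<open>asc\<close>:
  appending 1 to \<open>[5]\<close> creates no ascent.\<close>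

definition saturating :: "(nat list \<Rightarrow> nat) \<Rightarrow> bool" where
  "saturating st \<longleftrightarrow> (\<forall>q. restricted_growth st q \<longrightarrow> st (q @ [st q + 1]) = st q + 1)"

text \<open>By saturation two successive maximal entries differ by one, so one of the first two is
  odd; it flips the parity and only zeros follow.\<close>

lemma greedy_after_growing:
  assumes sat: "saturating st" and rg: "restricted_growth st s"
    and g: "greedy_after st e k s" and par: "even (sum_list (take (Suc k) s)) = e"
    and j: "k < j" "j < length s"
  defines "m \<equiv> st (take (Suc k) s) + 1"
  shows "s ! j = (if j = Suc k then m
     else if j = Suc (Suc k) then (if even m then m + 1 else 0) else 0)"
proof -
  have len: "Suc k < length s" using j by simp
  have s1: "s ! Suc k = m"
    using g par len unfolding greedy_after_def m_def by auto
  then have take2: "take (Suc (Suc k)) s = take (Suc k) s @ [m]"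
    using len by (simp add: take_Suc_conv_app_nth)
  have g1: "greedy_after st e (Suc k) s" and g2: "greedy_after st e (Suc (Suc k)) s"
    using g greedy_after_mono by auto
  show ?thesis
  proof (cases "even m")
    case False
    then have "even (sum_list (take (Suc (Suc k)) s)) \<noteq> e"
      using par by (auto simp: take2)
    then show ?thesis
      using greedy_after_zeros[OF g1 _ _ j(2)] s1 j False by auto
  next
    case True
    then have par2: "even (sum_list (take (Suc (Suc k)) s)) = e"
      using par by (auto simp: take2)
    have "restricted_growth st (take (Suc k) s)"
      by (rule restricted_growth_take[OF rg]) simp
    then have "st (take (Suc (Suc k)) s) = m"
      using sat unfolding take2 m_def saturating_def by blast
    then have s2: "s ! Suc (Suc k) = m + 1" if "Suc (Suc k) < length s"
      using that g par2 unfolding greedy_after_def by auto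
    have "s ! j = 0" if "Suc (Suc k) < j"
    proof -
      have "take (Suc (Suc (Suc k))) s = take (Suc (Suc k)) s @ [m + 1]"
        using that j s2 by (simp add: take_Suc_conv_app_nth[of "Suc (Suc k)"])
      then have "even (sum_list (take (Suc (Suc (Suc k))) s)) \<noteq> e"
        using par2 True by auto
      then show ?thesis
        using greedy_after_zeros[OF g2 _ that j(2)] by blast
    qed
    then show ?thesis
      using s1 s2 j True by auto
  qed
qed

section \<open>Consecutive sequences\<close>

text \<open>Since \<open>k\<close> belongs to \<open>D\<close>, the only possible gap is at
  \<open>k + 1\<close>, and the last hypothesis rules it out.\<close>

lemma interval_of_card_le_3:
  fixes k :: nat
  assumes "D \<subseteq> {k, Suc k, Suc (Suc k)}" "k \<in> D" "Suc (Suc k) \<in> D \<Longrightarrow> Suc k \<in> D"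
  shows "card D \<le> 3 \<and> (\<exists>a b. D = {a..b})"
proof -
  have "D = {k..k} \<or> D = {k..Suc k} \<or> D = {k..Suc (Suc k)}"
    using assms by (auto simp: atLeastAtMostSuc_conv)
  then have "\<exists>b \<le> k + 2. D = {k..b}"
    by (metis add_2_eq_Suc' le_add1 le_SucI order_refl)
  then show ?thesis by auto
qed

lemma diff_positions_greedy:
  assumes sat: "saturating st"
    and s: "s \<in> restricted_growth_seqs st n" and t: "t \<in> restricted_growth_seqs st n"
    and k: "k < n" "take k s = take k t" "even (s ! k) \<noteq> even (t ! k)"
    and gs: "greedy_after st True k s" and gt: "greedy_after st False k t"
  shows "card (diff_positions s t) \<le> 3 \<and> (\<exists>a b. diff_positions s t = {a..b})"
proof (rule interval_of_card_le_3)
  have len: "length s = n" "length t = n"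
    and rg: "restricted_growth st s" "restricted_growth st t"
    using s t by (auto simp: restricted_growth_seqs_def)
  have par: "even (sum_list (take (Suc k) s)) \<noteq> even (sum_list (take (Suc k) t))"
    using k len by (auto simp: take_Suc_conv_app_nth)
  show "k \<in> diff_positions s t"
    using k len by (auto simp: diff_positions_def)
  have low: "s ! j = t ! j" if "j < k" for j
    using nth_eq_of_take_eq[OF k(2) that] .
  \<comment> \<open>Opposite parities meet opposite values of \<open>e\<close>, so either both tails
    vanish at once or both start with a maximal entry.\<close>
  consider (zero) "\<And>j. k < j \<Longrightarrow> j < n \<Longrightarrow> s ! j = t ! j"
    | (grow) "even (sum_list (take (Suc k) s)) = True" "even (sum_list (take (Suc k) t)) = False"
    using par greedy_after_zeros[OF gs] greedy_after_zeros[OF gt] len by metis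
  note cases = this
  have eq: "s ! j = t ! j" if "j < n" "j \<notin> {k, Suc k, Suc (Suc k)}" for j
    using cases
  proof cases
    case zero
    then show ?thesis using that low by (cases j k rule: linorder_cases) auto
  next
    case grow
    then show ?thesis
      using that low[of j] greedy_after_growing[OF sat rg(1) gs grow(1), of j]
        greedy_after_growing[OF sat rg(2) gt grow(2), of j] len
      by (cases j k rule: linorder_cases) auto
  qed
  then show "diff_positions s t \<subseteq> {k, Suc k, Suc (Suc k)}"
    using len by (auto simp: diff_positions_def)
  \<comment> \<open>In the growing case the entry at \<open>k + 2\<close> is a function of the entry
    \<open>m\<close> at \<open>k + 1\<close>, the same function for \<open>s\<close> and
    \<open>t\<close>.\<close>
  show "Suc k \<in> diff_positions s t" if "Suc (Suc k) \<in> diff_positions s t"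
    using cases
  proof cases
    case zero
    then show ?thesis using that len by (auto simp: diff_positions_def)
  next
    case grow
    show ?thesis
      using that len greedy_after_growing[OF sat rg(1) gs grow(1)]
        greedy_after_growing[OF sat rg(2) gt grow(2)]
      by (auto simp: diff_positions_def split: if_splits)
  qed
qed

lemma consecutive_diff_positions:
  assumes sat: "saturating st"
    and s: "s \<in> restricted_growth_seqs st n" and t: "t \<in> restricted_growth_seqs st n"
    and less: "s \<prec> t"
    and cons: "\<And>u. u \<in> restricted_growth_seqs st n \<Longrightarrow> \<not> (s \<prec> u \<and> u \<prec> t)"
  shows "card (diff_positions s t) \<le> 3 \<and> (\<exists>a b. diff_positions s t = {a..b})"
proof -
  have len: "length u = n" if "u \<in> restricted_growth_seqs st n" for u
    using that by (auto simp: restricted_growth_seqs_def)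
  have bound: "u ! j \<le> st (take j u) + 1"
    if "u \<in> restricted_growth_seqs st n" "1 \<le> j" "j < n" for u j
    using that by (auto simp: restricted_growth_seqs_def restricted_growth_def)
  obtain k where k: "k < n" "take k s = take k t"
    "if even (sum_list (take k s)) then s ! k < t ! k else t ! k < s ! k"
    using less len[OF s] by (auto elim: rgc_lessE)
  have "s ! 0 = 0" "t ! 0 = 0"
    using s t by (auto simp: restricted_growth_seqs_def restricted_growth_def)
  \<comment> \<open>Position 0 is fixed, so \<open>k\<close> is a position whose entry may be
    changed.\<close>
  then have k1: "1 \<le> k"
    using k(3) by (cases k) auto

  have adjacent: "even (s ! k) \<noteq> even (t ! k)"
  proof (rule ccontr)
    assume A: "\<not> even (s ! k) \<noteq> even (t ! k)"
    \<comment> \<open>Distinct entries of equal parity differ by at least two, which leaves room for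
      \<open>v\<close> strictly between them.\<close>
    define v where "v = Suc (min (s ! k) (t ! k))"
    have v: "min (s ! k) (t ! k) < v" "v < max (s ! k) (t ! k)"
      using A k(3) by (auto simp: v_def min_def max_def split: if_splits) presburger+
    \<comment> \<open>The common prefix gives both entries the same bound, and \<open>v\<close> lies
      below the larger one.\<close>
    have "v \<le> st (take k s) + 1"
      using v(2) bound[OF s k1 k(1)] bound[OF t k1 k(1)] k(2) by auto
    then obtain u where u: "u \<in> restricted_growth_seqs st n" "take k u = take k s" "u ! k = v"
      using restricted_growth_seqs_change_entry[OF s k1 k(1)] by blast
    have "s \<prec> u" "u \<prec> t"
      using u k v len[OF s] len[OF t] len[OF u(1)]
      by (auto intro!: rgc_lessI[of _ _ k] split: if_splits)
    then show False using cons[OF u(1)] by blast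
  qed

  have gs: "greedy_after st True k s"
    unfolding greedy_after_def
  proof (intro allI impI, rule ccontr)
    fix j assume j: "k < j \<and> j < length s"
    \<comment> \<open>\<open>?v\<close> is the admissible value that comes last in the order after
      this prefix, so a deviation puts \<open>u\<close> after \<open>s\<close>. As \<open>u\<close>
      agrees with \<open>s\<close> up to and including \<open>k\<close>, it stays before
      \<open>t\<close>.\<close>
    let ?v = "if even (sum_list (take j s)) = True then st (take j s) + 1 else 0"
    assume A: "s ! j \<noteq> ?v"
    have j': "1 \<le> j" "j < n" using j len[OF s] by auto
    have "?v \<le> st (take j s) + 1" by simp
    then obtain u where u: "u \<in> restricted_growth_seqs st n" "take j u = take j s" "u ! j = ?v"
      using restricted_growth_seqs_change_entry[OF s j'] by blast
    have "s \<prec> u"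
      using u A bound[OF s j'] len[OF s] len[OF u(1)] j' by (intro rgc_lessI[of _ _ j]) auto
    moreover have "u \<prec> t"
      using take_eq_le[OF u(2), of k] nth_eq_of_take_eq[OF u(2), of k] j k len[OF t] len[OF u(1)]
      by (intro rgc_lessI[of _ _ k]) auto
    ultimately show False using cons[OF u(1)] by blast
  qed

  have gt: "greedy_after st False k t"
    unfolding greedy_after_def
  proof (intro allI impI, rule ccontr)
    fix j assume j: "k < j \<and> j < length t"
    \<comment> \<open>Mirror image: \<open>?v\<close> now comes first in the order, so
      \<open>u\<close> precedes \<open>t\<close> while its entry at \<open>k\<close> keeps it after
      \<open>s\<close>.\<close>
    let ?v = "if even (sum_list (take j t)) = False then st (take j t) + 1 else 0"
    assume A: "t ! j \<noteq> ?v"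
    have j': "1 \<le> j" "j < n" using j len[OF t] by auto
    have "?v \<le> st (take j t) + 1" by simp
    then obtain u where u: "u \<in> restricted_growth_seqs st n" "take j u = take j t" "u ! j = ?v"
      using restricted_growth_seqs_change_entry[OF t j'] by blast
    have "u \<prec> t"
      using u A bound[OF t j'] len[OF t] len[OF u(1)] j' by (intro rgc_lessI[of _ _ j]) auto
    moreover have "s \<prec> u"
      using take_eq_le[OF u(2), of k] nth_eq_of_take_eq[OF u(2), of k] j k len[OF s] len[OF u(1)]
      by (intro rgc_lessI[of _ _ k]) auto
    ultimately show False using cons[OF u(1)] by blast
  qed

  show ?thesis
    using diff_positions_greedy[OF sat s t k(1,2) adjacent gs gt] .
qed

lemma saturating_adjacent_gray_code:
  assumes sat: "saturating st" and L: "rgc_listing (restricted_growth_seqs st n) L"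
  shows "adjacent_gray_code 3 L"
proof -
  have "card (diff_positions (L ! i) (L ! Suc i)) \<le> 3 \<and>
      (\<exists>a b. diff_positions (L ! i) (L ! Suc i) = {a..b})" if i: "Suc i < length L" for i
  proof (rule consecutive_diff_positions[OF sat])
    have set: "set L = restricted_growth_seqs st n" and sorted: "sorted_wrt (\<prec>) L"
      using L by (auto simp: rgc_listing_def)
    show "L ! i \<in> restricted_growth_seqs st n" "L ! Suc i \<in> restricted_growth_seqs st n"
      using i set nth_mem[of i L] nth_mem[of "Suc i" L] by auto
    show "L ! i \<prec> L ! Suc i"
      using sorted i by (simp add: sorted_wrt_iff_nth_less)
    show "\<not> (L ! i \<prec> u \<and> u \<prec> L ! Suc i)" if "u \<in> restricted_growth_seqs st n" for u
      using sorted_wrt_no_between[OF transp_rgc_less irreflp_rgc_less sorted i] that set by simp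
  qed
  then show ?thesis
    by (simp add: adjacent_gray_code_def gray_code_def hamming_dist_def)
qed

section \<open>The three statistics\<close>

lemma saturating_lv: "saturating lv"
  by (simp add: saturating_def lv_def)

lemma saturating_max_entry: "saturating max_entry"
  by (auto simp: saturating_def max_entry_def restricted_growth_def)

lemma asc_snoc:
  assumes "q \<noteq> []"
  shows "asc (q @ [x]) = asc q + (if last q < x then 1 else 0)"
proof -
  let ?A = "{i. Suc i < length q \<and> q ! i < q ! Suc i}"
  have fin: "finite ?A"
    by (rule finite_subset[of _ "{..<length q}"]) auto
  have "{i. Suc i < length (q @ [x]) \<and> (q @ [x]) ! i < (q @ [x]) ! Suc i}
      = ?A \<union> (if last q < x then {length q - 1} else {})"
    (is "?B = _")
  proof (rule set_eqI)
    fix i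
    have "0 < length q" using assms by simp
    then consider "Suc i < length q" | "i = length q - 1" | "length q \<le> i" "i \<noteq> length q - 1"
      by linarith
    then show "i \<in> ?B \<longleftrightarrow> i \<in> ?A \<union> (if last q < x then {length q - 1} else {})"
      using assms by cases (auto simp: nth_append last_conv_nth)
  qed
  moreover have "length q - 1 \<notin> ?A"
    using assms by auto
  ultimately show ?thesis
    using fin by (simp add: asc_def)
qed

text \<open>Guarantees that appending \<open>asc q + 1\<close> creates an ascent. In the induction a
  new entry either makes an ascent and is at most \<open>asc q + 1\<close>, or is at most the old
  last entry.\<close>

lemma last_le_asc:
  assumes "restricted_growth asc q"
  shows "last q \<le> asc q"
  using assms
proof (induction q rule: rev_induct)
  case Nil
  then show ?case by (simp add: restricted_growth_def)
next
  case (snoc x q)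
  show ?case
  proof (cases "q = []")
    case True
    then show ?thesis using snoc.prems by (simp add: restricted_growth_def)
  next
    case False
    then show ?thesis
      using snoc restricted_growth_snoc[OF False, of asc x] by (auto simp: asc_snoc)
  qed
qed

lemma saturating_asc: "saturating asc"
  unfolding saturating_def
proof (intro allI impI)
  fix q assume "restricted_growth asc q"
  moreover from this have "q \<noteq> []" by (simp add: restricted_growth_def)
  ultimately show "asc (q @ [asc q + 1]) = asc q + 1"
    using last_le_asc[of q] by (simp add: asc_snoc)
qed

theorem theorem1:
  fixes n :: nat
  assumes "n \<ge> 1"
  shows "\<forall>X \<in> {ascent_seqs n, restricted_growth_funs n, staircase_words n}.
           (\<exists>!L. rgc_listing X L) \<and>
           (\<forall>L. rgc_listing X L \<longrightarrow> adjacent_gray_code 3 L)"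
  using restricted_growth_seqs_listing_unique saturating_adjacent_gray_code
    saturating_asc saturating_max_entry saturating_lv
  unfolding ascent_seqs_def restricted_growth_funs_def staircase_words_def by blast

end
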